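(* If $G$ is a partial cube and $u\in V(G)$, then $D_{G,u}(x,y)\le W_{G,u}(x+y)$, i.e. for all $k,t\ge 0$ the coefficient of $x^ky^t$ in $D_{G,u}(x,y)$ is at most the coefficient of $x^ky^t$ in the polynomial $W_{G,u}(x+y)$.
   Context: A partial cube is a graph isomorphic to an isometric subgraph of some hypercube $Q_n$. For a graph $G$ and $u\in V(G)$: $W_{G,u}(x)=\sum_{d\ge0}w_d x^d$, where $w_d$ is the number of vertices of $G$ at distance $d$ from $u$; $D_{G,u}(x,y)=\sum_{k,d\ge0}c_{k,d}x^ky^d$, where $c_{k,d}$ is the number of induced subgraphs of $G$ isomorphic to the hypercube $Q_k$ at distance $d$ from $u$ (distance from $u$ to a subgraph $H$ being $\min_{h\in V(H)}d_G(u,h)$). For polynomials $P,Q$ in the same variables, $P\le Q$ means each coefficient of $P$ is at most the corresponding coefficient of $Q$. *)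

theory Defs
  imports
    "Graph_Theory.Graph_Theory"
    "HOL-Computational_Algebra.Polynomial"
begin

text \<open>
  Finite simple graphs are the loop-free symmetric digraphs without parallel arcs of the locale
  \<^locale>\<open>graph\<close>.
\<close>

definition gdist :: "('a,'b) pre_digraph \<Rightarrow> 'a \<Rightarrow> 'a \<Rightarrow> ereal" where
  "gdist G u v = wf_digraph.\<mu> G (\<lambda>_. 1) u v"

definition hypercube :: "nat \<Rightarrow> (bool list, bool list \<times> bool list) pre_digraph" where
  "hypercube n = with_proj
     \<lparr> pverts = {x. length x = n},
       parcs = {(x, y). length x = n \<and> length y = n \<and> card {i. i < n \<and> x ! i \<noteq> y ! i} = 1} \<rparr>"

text \<open>
  \<^const>\<open>subgraph\<close> alone would allow to keep only one of the two arcs that make up an edge; hence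
  the requirement that the subgraph be a \<^const>\<open>graph\<close>.
\<close>
definition isometric_subgraph :: "('a,'b) pre_digraph \<Rightarrow> ('a,'b) pre_digraph \<Rightarrow> bool" where
  "isometric_subgraph H G \<longleftrightarrow> graph H \<and> subgraph H G \<and>
     (\<forall>u \<in> verts H. \<forall>v \<in> verts H. gdist H u v = gdist G u v)"

definition partial_cube :: "('a,'b) pre_digraph \<Rightarrow> bool" where
  "partial_cube G \<longleftrightarrow> graph G \<and> (\<exists>n H. isometric_subgraph H (hypercube n) \<and> digraph_iso G H)"

definition verts_at_dist :: "('a,'b) pre_digraph \<Rightarrow> 'a \<Rightarrow> nat \<Rightarrow> nat" where
  "verts_at_dist G u d = card {v \<in> verts G. gdist G u v = ereal (real d)}"

definition dist_to_subgraph :: "('a,'b) pre_digraph \<Rightarrow> 'a \<Rightarrow> ('a,'b) pre_digraph \<Rightarrow> ereal" where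
  "dist_to_subgraph G u H = Min (gdist G u ` verts H)"

definition cubes_at_dist :: "('a,'b) pre_digraph \<Rightarrow> 'a \<Rightarrow> nat \<Rightarrow> nat \<Rightarrow> nat" where
  "cubes_at_dist G u k d = card {H. induced_subgraph H G \<and> digraph_iso H (hypercube k) \<and>
     dist_to_subgraph G u H = ereal (real d)}"

text \<open>
  Polynomials in \<open>x\<close> and \<open>y\<close> are polynomials in \<open>y\<close> whose coefficients are polynomials in \<open>x\<close>.
\<close>
definition coeff2 :: "'a::zero poly poly \<Rightarrow> nat \<Rightarrow> nat \<Rightarrow> 'a" where
  "coeff2 P k t = coeff (coeff P t) k"

definition var_x :: "'a::comm_semiring_1 poly poly" where
  "var_x = [:[:0, 1:]:]"

definition var_y :: "'a::comm_semiring_1 poly poly" where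
  "var_y = [:0, 1:]"

definition poly2_le :: "'a::{zero,ord} poly poly \<Rightarrow> 'a poly poly \<Rightarrow> bool"  (infix \<open>\<preceq>\<close> 50) where
  "P \<preceq> Q \<longleftrightarrow> (\<forall>k t. coeff2 P k t \<le> coeff2 Q k t)"

definition subst2 :: "'a::comm_semiring_1 poly \<Rightarrow> 'a poly poly \<Rightarrow> 'a poly poly" where
  "subst2 P q = poly (map_poly (\<lambda>c. [:[:c:]:]) P) q"

text \<open>
  The sums below range over the supports of the coefficient families, which are finite for finite
  graphs; see \<open>coeff_W_poly\<close> and \<open>coeff2_D_poly\<close>.
\<close>
definition W_poly :: "('a,'b) pre_digraph \<Rightarrow> 'a \<Rightarrow> nat poly" where
  "W_poly G u = (\<Sum>d \<in> {d. verts_at_dist G u d \<noteq> 0}. monom (verts_at_dist G u d) d)"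

definition D_poly :: "('a,'b) pre_digraph \<Rightarrow> 'a \<Rightarrow> nat poly poly" where
  "D_poly G u = (\<Sum>(k, d) \<in> {(k, d). cubes_at_dist G u k d \<noteq> 0}.
     monom (monom (cubes_at_dist G u k d) k) d)"

lemma coeff_W_poly:
  assumes "finite (verts G)"
  shows "coeff (W_poly G u) d = verts_at_dist G u d"
proof -
  let ?S = "{d. verts_at_dist G u d \<noteq> 0}"
  have "(\<lambda>d. ereal (real d)) ` ?S \<subseteq> gdist G u ` verts G"
  proof clarify
    fix d assume "0 < verts_at_dist G u d"
    then have "{v \<in> verts G. gdist G u v = ereal (real d)} \<noteq> {}"
      unfolding verts_at_dist_def by (metis card.empty less_irrefl)
    then show "ereal (real d) \<in> gdist G u ` verts G" by (metis (mono_tags, lifting) Collect_empty_eq image_eqI)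
  qed
  then have "finite ((\<lambda>d. ereal (real d)) ` ?S)"
    using assms by (meson finite_imageI finite_subset)
  then have fin: "finite ?S"
    by (rule finite_imageD) (auto intro: inj_onI)
  show ?thesis
    unfolding W_poly_def coeff_sum coeff_monom
    using fin by (simp add: sum.delta)
qed

lemma card_verts_hypercube: "card (verts (hypercube k)) = 2 ^ k"
  using card_lists_length_eq[of "UNIV :: bool set" k] by (simp add: hypercube_def)

lemma coeff2_D_poly:
  assumes "finite (verts G)" and "finite (arcs G)"
  shows "coeff2 (D_poly G u) k d = cubes_at_dist G u k d"
proof -
  let ?S = "{(k, d). cubes_at_dist G u k d \<noteq> 0}"
  let ?h = "\<lambda>H. (card (verts H), dist_to_subgraph G u H)"
  let ?f = "\<lambda>(k::nat, d). (2 ^ k :: nat, ereal (real d))"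
  have sub: "{H. induced_subgraph H G} \<subseteq>
      (\<lambda>(V, A). \<lparr> verts = V, arcs = A, tail = tail G, head = head G \<rparr>) ` (Pow (verts G) \<times> Pow (arcs G))"
  proof clarify
    fix H assume "induced_subgraph H G"
    then have "H = \<lparr> verts = verts H, arcs = arcs H, tail = tail G, head = head G \<rparr>"
      "verts H \<subseteq> verts G" "arcs H \<subseteq> arcs G"
      by (auto simp: induced_subgraph_def subgraph_def compatible_def)
    then show "H \<in> (\<lambda>(V, A). \<lparr> verts = V, arcs = A, tail = tail G, head = head G \<rparr>) `
        (Pow (verts G) \<times> Pow (arcs G))"
      by (intro image_eqI[where x = "(verts H, arcs H)"]) auto
  qed
  have fin_ind: "finite {H. induced_subgraph H G}"
    by (rule finite_subset[OF sub]) (use assms in simp)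
  have "?f ` ?S \<subseteq> ?h ` {H. induced_subgraph H G}"
  proof clarify
    fix k d assume "0 < cubes_at_dist G u k d"
    then have "{H. induced_subgraph H G \<and> digraph_iso H (hypercube k) \<and>
        dist_to_subgraph G u H = ereal (real d)} \<noteq> {}"
      unfolding cubes_at_dist_def by (metis card.empty less_irrefl)
    then obtain H where H: "induced_subgraph H G" "digraph_iso H (hypercube k)"
        "dist_to_subgraph G u H = ereal (real d)"
      by blast
    from H(2) obtain f where f: "pre_digraph.digraph_isomorphism H f" "hypercube k = app_iso f H"
      by (auto simp: digraph_iso_def)
    then have "card (verts (hypercube k)) = card (verts H)"
      by (simp add: card_image pre_digraph.digraph_isomorphism_def)
    then have "card (verts H) = 2 ^ k"
      by (simp add: card_verts_hypercube)
    with H show "(2 ^ k, ereal (real d)) \<in> ?h ` {H. induced_subgraph H G}"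
      by (intro image_eqI[where x = H]) auto
  qed
  then have "finite (?f ` ?S)"
    using fin_ind by (meson finite_imageI finite_subset)
  then have fin: "finite ?S"
    by (rule finite_imageD) (auto intro!: inj_onI)
  have "coeff2 (D_poly G u) k d =
      (\<Sum>p \<in> ?S. if p = (k, d) then cubes_at_dist G u k d else 0)"
    unfolding D_poly_def coeff2_def coeff_sum
    by (rule sum.cong) (auto split: if_splits)
  also have "\<dots> = cubes_at_dist G u k d"
    using fin by (simp add: sum.delta)
  finally show ?thesis .
qed

end

theory Submission
  imports Defs
begin

text \<open>
  The coefficient of \<open>x^k y^t\<close> in \<open>W(x + y)\<close> is \<open>w_(k+t)\<close> times \<open>k + t choose k\<close>. Embed the partial
  cube isometrically in a hypercube and label each vertex \<open>v\<close> by the set \<open>a v\<close> of the coordinates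
  in which it differs from \<open>u\<close>, so that its distance from \<open>u\<close> is \<open>card (a v)\<close>. The labels of an
  induced \<open>k\<close>-cube form an interval \<open>{M - D..M}\<close> with \<open>card D = k\<close>: its distance from \<open>u\<close> is
  \<open>card (M - D)\<close>, and its farthest vertex, labelled \<open>M\<close>, has distance \<open>k + t\<close>. The cube is determined
  by that vertex and by the \<open>k\<close>-subset \<open>D\<close> of its label.
\<close>

section \<open>Coefficients of \<open>W(x + y)\<close>\<close>

lemma coeff2_var_power:
  "coeff2 ((var_x + var_y :: 'a::comm_semiring_1 poly poly) ^ d) k t = (if k + t = d then of_nat (d choose k) else 0)"
proof -
  have x: "(var_x :: 'a poly poly) ^ i = [:monom 1 i:]" for i
    by (induction i) (auto simp: var_x_def one_pCons monom_Suc)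
  have y: "(var_y :: 'a poly poly) ^ i = monom 1 i" for i
    by (induction i) (auto simp: var_y_def monom_Suc)
  have summand: "coeff2 (of_nat (d choose i) * var_x ^ i * var_y ^ (d - i) :: 'a poly poly) k t =
      (if k = i \<and> t = d - i then of_nat (d choose i) else 0)" for i
    unfolding x y coeff2_def by (simp add: of_nat_poly smult_monom)
  have "coeff2 ((var_x + var_y :: 'a poly poly) ^ d) k t =
      (\<Sum>i\<le>d. if k = i \<and> t = d - i then of_nat (d choose i) else 0)"
    unfolding binomial_ring summand[symmetric] by (simp add: coeff2_def coeff_sum)
  \<comment> \<open>Nested conditions put the sum into the form of \<open>sum.delta\<close>. Since
    \<open>i \<le> d\<close>, the subtraction \<open>d - i\<close> is never truncated; for
    \<open>k > d\<close> the index \<open>k\<close> is out of range and both sides are 0.\<close>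
  also have "\<dots> = (\<Sum>i\<le>d. if i = k then if t = d - i then of_nat (d choose i) else 0 else 0)"
    by (rule sum.cong) auto
  also have "\<dots> = (if k + t = d then of_nat (d choose k) else 0)"
    by (subst sum.delta) auto
  finally show ?thesis .
qed

lemma coeff2_subst2:
  "coeff2 (subst2 (P :: 'a::comm_semiring_1 poly) (var_x + var_y)) k t = of_nat (k + t choose k) * coeff P (k + t)"
proof -
  have "subst2 P (var_x + var_y) =
      (\<Sum>i\<le>degree P. [:[:coeff P i:]:] * (var_x + var_y) ^ i)"
    unfolding subst2_def
    by (simp add: poly_altdef degree_map_poly coeff_map_poly)
  then have "coeff2 (subst2 P (var_x + var_y)) k t =
      (\<Sum>i\<le>degree P. coeff P i * coeff2 ((var_x + var_y) ^ i) k t)"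
    by (simp add: coeff2_def coeff_sum)
  also have "\<dots> = (\<Sum>i\<le>degree P. if i = k + t then coeff P i * of_nat (i choose k) else 0)"
    by (rule sum.cong) (auto simp: coeff2_var_power)
  also have "\<dots> = of_nat (k + t choose k) * coeff P (k + t)"
    \<comment> \<open>If \<open>k + t\<close> exceeds the degree, no summand survives, and
      \<open>coeff P (k + t)\<close> is 0 as well.\<close>
    by (subst sum.delta) (auto simp: coeff_eq_0 mult.commute)
  finally show ?thesis .
qed

section \<open>Edge-preserving embeddings of a cube into a lattice of sets\<close>

lemma card_sym_diff_eq_1E:
  assumes "card (sym_diff A B) = 1"
  obtains x where "B = sym_diff A {x}"
proof -
  from assms obtain x where "sym_diff A B = {x}" by (rule card_1_singletonE)
  then have "B = sym_diff A {x}" by blast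
  then show ?thesis by (rule that)
qed

lemma sym_diff_insert: "x \<notin> A \<Longrightarrow> sym_diff B (insert x A) = sym_diff (sym_diff B A) {x}"
  by blast

text \<open>Opposite edges of a 4-cycle in a hypercube change the same coordinate.\<close>
lemma sym_diff_square:
  assumes "sym_diff (sym_diff T {x}) {a} = sym_diff (sym_diff T {y}) {b}" and "x \<noteq> y"
    and "sym_diff (sym_diff T {x}) {a} \<noteq> T"
  shows "a = y"
  using assms by (auto simp: set_eq_iff)

lemma cube_embedding_image:
  assumes "finite I" and inj: "inj_on g (Pow I)"
    and adj: "\<And>S i. S \<subseteq> I \<Longrightarrow> i \<in> I \<Longrightarrow> i \<notin> S \<Longrightarrow> card (sym_diff (g S) (g (insert i S))) = 1"
  obtains D where "finite D" and "card D = card I" and "g ` Pow I = {X. sym_diff X (g {}) \<subseteq> D}"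
proof -
  have "\<forall>i\<in>I. \<exists>x. g {i} = sym_diff (g {}) {x}"
  proof
    fix i assume "i \<in> I"
    then have "card (sym_diff (g {}) (g {i})) = 1" using adj[of "{}" i] by simp
    then show "\<exists>x. g {i} = sym_diff (g {}) {x}" by (rule card_sym_diff_eq_1E) blast
  qed
  then obtain \<phi> where \<phi>: "\<And>i. i \<in> I \<Longrightarrow> g {i} = sym_diff (g {}) {\<phi> i}"
    unfolding bchoice_iff by blast
  have inj_\<phi>: "inj_on \<phi> I"
  proof (rule inj_onI)
    fix i j assume "i \<in> I" "j \<in> I" "\<phi> i = \<phi> j"
    then have "g {i} = g {j}" using \<phi> by simp
    with \<open>i \<in> I\<close> \<open>j \<in> I\<close> show "i = j" using inj_onD[OF inj, of "{i}" "{j}"] by simp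
  qed
  have g_eq: "g S = sym_diff (g {}) (\<phi> ` S)" if "S \<subseteq> I" for S
    using finite_subset[OF that \<open>finite I\<close>] that
  \<comment> \<open>A set with at least two elements is the top of a square whose three other
    corners \<open>T\<close>, \<open>insert i T\<close> and \<open>insert j T\<close> are all proper
    subsets, so the hypothesis is needed for all of them.\<close>
  proof (induction S rule: finite_psubset_induct)
    case (psubset S)
    consider "S = {}" | i where "S = {i}" | i j T where "S = insert i (insert j T)" "i \<noteq> j" "i \<notin> T" "j \<notin> T"
    proof (cases "\<exists>i j. i \<in> S \<and> j \<in> S \<and> i \<noteq> j")
      case True
      then obtain i j where "i \<in> S" "j \<in> S" "i \<noteq> j" by blast
      then show ?thesis by (intro that(3)[of i j "S - {i, j}"]) auto
    next
      case False
      then show ?thesis using that(1,2) by blast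
    qed
    then show ?case
    proof cases
      case 1
      then show ?thesis by simp
    next
      case 2
      with psubset.prems show ?thesis using \<phi> by simp
    next
      case 3
      have ij: "i \<in> I" "j \<in> I" and T: "T \<subseteq> I" using 3 psubset.prems by auto
      have gT: "g T = sym_diff (g {}) (\<phi> ` T)"
        using 3 T by (intro psubset.IH) auto
      have \<phi>T: "\<phi> i \<notin> \<phi> ` T" "\<phi> j \<notin> \<phi> ` T" "\<phi> i \<noteq> \<phi> j"
        using 3 ij T inj_\<phi> by (auto dest: inj_onD)
      have "g (insert i T) = sym_diff (g {}) (\<phi> ` insert i T)"
        using 3 ij T by (intro psubset.IH) auto
      then have gi: "g (insert i T) = sym_diff (g T) {\<phi> i}"
        by (simp only: gT image_insert sym_diff_insert[OF \<phi>T(1)])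
      have "g (insert j T) = sym_diff (g {}) (\<phi> ` insert j T)"
        using 3 ij T by (intro psubset.IH) auto
      then have gj: "g (insert j T) = sym_diff (g T) {\<phi> j}"
        by (simp only: gT image_insert sym_diff_insert[OF \<phi>T(2)])
      have "card (sym_diff (g (insert i T)) (g S)) = 1"
        using adj[of "insert i T" j] 3 ij T by (simp add: insert_commute)
      then obtain a where a: "g S = sym_diff (g (insert i T)) {a}"
        by (rule card_sym_diff_eq_1E)
      have "card (sym_diff (g (insert j T)) (g S)) = 1"
        using adj[of "insert j T" i] 3 ij T by simp
      then obtain b where b: "g S = sym_diff (g (insert j T)) {b}"
        by (rule card_sym_diff_eq_1E)
      \<comment> \<open>Injectivity excludes the degenerate solution \<open>a = \<phi> i\<close>,
        \<open>b = \<phi> j\<close>, in which both paths return to \<open>g T\<close>.\<close>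
      have "g S \<noteq> g T"
        using inj_onD[OF inj, of S T] psubset.prems 3 T by auto
      then have "a = \<phi> j"
        using sym_diff_square[of "g T" "\<phi> i" a "\<phi> j" b] \<phi>T a b gi gj by simp
      then have "g S = sym_diff (sym_diff (g T) {\<phi> i}) {\<phi> j}"
        using a gi by simp
      also have "\<dots> = sym_diff (sym_diff (g {}) (insert (\<phi> i) (\<phi> ` T))) {\<phi> j}"
        by (simp only: gT sym_diff_insert[OF \<phi>T(1)])
      also have "\<dots> = sym_diff (g {}) (insert (\<phi> j) (insert (\<phi> i) (\<phi> ` T)))"
        by (rule sym_diff_insert[symmetric]) (use \<phi>T in simp)
      also have "insert (\<phi> j) (insert (\<phi> i) (\<phi> ` T)) = \<phi> ` S"
        unfolding 3(1) by auto
      finally show ?thesis .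
    qed
  qed
  have "g ` Pow I = {X. sym_diff X (g {}) \<subseteq> \<phi> ` I}"
  proof (intro equalityI subsetI)
    fix X assume "X \<in> g ` Pow I"
    then obtain S where "S \<subseteq> I" "X = g S" by auto
    then have "X = sym_diff (g {}) (\<phi> ` S)" by (simp only: g_eq[of S])
    with \<open>S \<subseteq> I\<close> show "X \<in> {X. sym_diff X (g {}) \<subseteq> \<phi> ` I}"
      by blast
  next
    fix X assume "X \<in> {X. sym_diff X (g {}) \<subseteq> \<phi> ` I}"
    then obtain S where S: "S \<subseteq> I" "sym_diff X (g {}) = \<phi> ` S"
      by (auto simp: subset_image_iff)
    have "X = sym_diff (g {}) (sym_diff X (g {}))" by blast
    also have "\<dots> = g S" by (simp only: S(2) g_eq[OF S(1)])
    finally show "X \<in> g ` Pow I" using S by auto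
  qed
  then show ?thesis
    using that[of "\<phi> ` I"] \<open>finite I\<close> inj_\<phi> by (simp add: card_image)
qed

text \<open>The set \<open>g {}\<close> may sit anywhere in the image. Taking the top
  \<open>g {} \<union> D\<close> as reference point instead makes the description independent of the
  choice of origin in the cube.\<close>

corollary cube_embedding_interval:
  assumes "finite I" and "inj_on g (Pow I)"
    and "\<And>S i. S \<subseteq> I \<Longrightarrow> i \<in> I \<Longrightarrow> i \<notin> S \<Longrightarrow> card (sym_diff (g S) (g (insert i S))) = 1"
  obtains M D where "D \<subseteq> M" and "card D = card I" and "g ` Pow I = {M - D..M}"
proof -
  obtain D where D: "card D = card I" "g ` Pow I = {X. sym_diff X (g {}) \<subseteq> D}"
    by (rule cube_embedding_image[OF assms])
  have "{X. sym_diff X (g {}) \<subseteq> D} = {(g {} \<union> D) - D..g {} \<union> D}" by auto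
  with D show ?thesis by (intro that[of D "g {} \<union> D"]) auto
qed

section \<open>Distance through walk lengths, and its invariance under isomorphism\<close>

lemma (in wf_digraph) gdist_le_length: "awalk u p v \<Longrightarrow> gdist G u v \<le> ereal (length p)"
  unfolding gdist_def using min_cost_le_walk_cost[of u p v "\<lambda>_. 1"]
  by (simp add: awalk_cost_def sum_list_triv)

lemma (in wf_digraph) gdist_geI:
  assumes "\<And>p. awalk u p v \<Longrightarrow> c \<le> ereal (length p)"
  shows "c \<le> gdist G u v"
  unfolding gdist_def \<mu>_def using assms
  by (intro INF_greatest) (simp add: awalk_cost_def sum_list_triv)

lemma (in wf_digraph) gdist_app_iso_le:
  assumes "digraph_isomorphism h"
  shows "gdist (app_iso h G) (iso_verts h u) (iso_verts h v) \<le> gdist G u v"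
proof (rule gdist_geI)
  fix p assume "awalk u p v"
  then have "pre_digraph.awalk (app_iso h G) (iso_verts h u) (map (iso_arcs h) p) (iso_verts h v)"
    using assms by (rule awalk_app_isoI)
  then show "gdist (app_iso h G) (iso_verts h u) (iso_verts h v) \<le> ereal (length p)"
    using wf_digraph.gdist_le_length[OF wf_digraphI_app_iso[OF assms]] by fastforce
qed

text \<open>Isomorphisms carry walks to walks of equal length; the inverse isomorphism supplies the
  reverse inequality.\<close>

lemma (in wf_digraph) gdist_app_iso:
  assumes h: "digraph_isomorphism h" and "u \<in> verts G" and "v \<in> verts G"
  shows "gdist (app_iso h G) (iso_verts h u) (iso_verts h v) = gdist G u v"
proof (rule antisym)
  show "gdist G u v \<le> gdist (app_iso h G) (iso_verts h u) (iso_verts h v)"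
    using wf_digraph.gdist_app_iso_le[OF wf_digraphI_app_iso[OF h] digraph_isomorphism_invI[OF h],
        of "iso_verts h u" "iso_verts h v"] assms by simp
qed (rule gdist_app_iso_le[OF h])

section \<open>Distances in the hypercube\<close>

definition diff_set :: "nat \<Rightarrow> bool list \<Rightarrow> bool list \<Rightarrow> nat set" where
  "diff_set n x y = {i. i < n \<and> x ! i \<noteq> y ! i}"

lemma finite_diff_set [simp]: "finite (diff_set n x y)"
  by (simp add: diff_set_def)

text \<open>Entries are Boolean: two entries that both differ from the entry of \<open>u\<close> are
  equal. Hence translating by \<open>u\<close> keeps all differences.\<close>

lemma sym_diff_diff_set: "sym_diff (diff_set n u x) (diff_set n u y) = diff_set n x y"
  by (auto simp: diff_set_def)

lemma diff_set_eq_empty_iff: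
  "length x = n \<Longrightarrow> length y = n \<Longrightarrow> diff_set n x y = {} \<longleftrightarrow> x = y"
  by (auto simp: diff_set_def list_eq_iff_nth_eq)

lemma hypercube_simps [simp]:
  "verts (hypercube n) = {x. length x = n}"
  "arcs (hypercube n) = {(x, y). length x = n \<and> length y = n \<and> card (diff_set n x y) = 1}"
  "tail (hypercube n) = fst" "head (hypercube n) = snd"
  by (simp_all add: hypercube_def diff_set_def)

lemma wf_digraph_hypercube: "wf_digraph (hypercube n)"
  by unfold_locales auto

text \<open>An arc changes one coordinate, so a walk has at least as many arcs as there are
  differing coordinates; correcting these one at a time attains the bound.\<close>

lemma gdist_hypercube:
  assumes "length x = n" and "length y = n"
  shows "gdist (hypercube n) x y = ereal (card (diff_set n x y))"
proof -
  interpret wf_digraph "hypercube n" by (rule wf_digraph_hypercube)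
  have "card (diff_set n x y) \<le> length p" if "awalk x p y" for p
    using that
  proof (induction p arbitrary: x)
    case Nil
    then show ?case by (simp add: awalk_Nil_iff diff_set_def)
  next
    case (Cons e p)
    then have e: "fst e = x" "card (diff_set n x (snd e)) = 1" and IH: "card (diff_set n (snd e) y) \<le> length p"
      by (auto simp: awalk_Cons_iff)
    have "diff_set n x y \<subseteq> diff_set n x (snd e) \<union> diff_set n (snd e) y"
      by (auto simp: diff_set_def)
    then have "card (diff_set n x y) \<le> card (diff_set n x (snd e)) + card (diff_set n (snd e) y)"
      by (meson card_Un_le card_mono finite_UnI finite_diff_set le_trans)
    with e IH show ?case by simp
  qed
  moreover have "\<exists>p. awalk x p y \<and> length p = card (diff_set n x y)"
    using assms
  proof (induction "card (diff_set n x y)" arbitrary: x)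
    case 0
    then have "x = y" by (simp add: diff_set_eq_empty_iff)
    with 0 show ?case by (intro exI[of _ "[]"]) (simp add: awalk_Nil_iff)
  next
    case (Suc m)
    then obtain i where i: "i \<in> diff_set n x y"
      by (metis card.empty ex_in_conv nat.distinct(1))
    define z where "z = x[i := y ! i]"
    have "diff_set n z y = diff_set n x y - {i}" "diff_set n x z = {i}"
      using i Suc.prems by (auto simp: diff_set_def z_def nth_list_update)
    then have z: "card (diff_set n z y) = m" "card (diff_set n x z) = 1" "length z = n"
      using i Suc by (auto simp: z_def)
    then obtain p where "awalk z p y" "length p = m"
      using Suc by metis
    with z Suc show ?case
      by (intro exI[of _ "(x, z) # p"]) (auto simp: awalk_Cons_iff)
  qed
  ultimately show ?thesis
    by (intro antisym gdist_geI) (auto dest: gdist_le_length)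
qed

section \<open>Labels of the vertices of a partial cube and of the cubes in it\<close>

text \<open>
  An isometric embedding into a hypercube translated so that \<open>u\<close> goes to the origin, with only the
  distances from \<open>u\<close> recorded.
\<close>
definition cube_labelling :: "('a,'b) pre_digraph \<Rightarrow> 'a \<Rightarrow> ('a \<Rightarrow> 'c set) \<Rightarrow> bool" where
  "cube_labelling G u a \<longleftrightarrow> inj_on a (verts G) \<and>
     (\<forall>v \<in> verts G. finite (a v) \<and> gdist G u v = ereal (card (a v))) \<and>
     (\<forall>e \<in> arcs G. card (sym_diff (a (tail G e)) (a (head G e))) = 1)"

text \<open>Isometry turns distances from \<open>u\<close> into sizes of difference sets.
  Injectivity and the arc condition are inherited from the embedding, because symmetric differences
  of labels are difference sets in the hypercube.\<close>

lemma partial_cube_labelling: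
  assumes "partial_cube G" and u: "u \<in> verts G"
  obtains a :: "'a \<Rightarrow> nat set" where "cube_labelling G u a"
proof -
  from assms(1) obtain n H h where "graph G" and iso: "isometric_subgraph H (hypercube n)"
    and h: "pre_digraph.digraph_isomorphism G h" and H: "H = app_iso h G"
    by (auto simp: partial_cube_def digraph_iso_def)
  interpret graph G by fact
  from iso have sub: "subgraph H (hypercube n)"
    by (simp add: isometric_subgraph_def)
  have len: "length (iso_verts h v) = n" if "v \<in> verts G" for v
    using that sub H by (auto simp: subgraph_def)
  define a where "a v = diff_set n (iso_verts h u) (iso_verts h v)" for v
  have "inj_on a (verts G)"
  proof (rule inj_onI)
    fix v w assume vw: "v \<in> verts G" "w \<in> verts G" "a v = a w"
    then have "diff_set n (iso_verts h v) (iso_verts h w) = {}"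
      unfolding a_def using sym_diff_diff_set by (metis Diff_cancel Un_absorb)
    with vw h len show "v = w" by (simp add: diff_set_eq_empty_iff)
  qed
  moreover have "gdist G u v = ereal (card (a v))" if "v \<in> verts G" for v
  proof -
    have "gdist G u v = gdist H (iso_verts h u) (iso_verts h v)"
      unfolding H using h u that by (simp add: gdist_app_iso)
    also have "\<dots> = gdist (hypercube n) (iso_verts h u) (iso_verts h v)"
      using iso u that by (simp add: isometric_subgraph_def H)
    finally show ?thesis using u that len by (simp add: gdist_hypercube a_def)
  qed
  moreover have "card (sym_diff (a (tail G e)) (a (head G e))) = 1" if "e \<in> arcs G" for e
  proof -
    have "iso_arcs h e \<in> arcs (hypercube n)" "tail H = fst" "head H = snd"
      using that sub by (auto simp: subgraph_def compatible_def H)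
    then show ?thesis
      using iso_verts_tail[OF h that] iso_verts_head[OF h that]
      by (auto simp: a_def sym_diff_diff_set H split_beta)
  qed
  ultimately have "cube_labelling G u a"
    by (auto simp: cube_labelling_def a_def)
  then show ?thesis by (rule that)
qed

text \<open>Subsets of \<open>{..<k}\<close> parametrise the vertices of \<open>H\<close>, and
  adding one element to a subset follows an arc of \<open>H\<close>, along which the label changes
  by one element. So \<open>cube_embedding_interval\<close> applies to the labels.\<close>

lemma cube_labels_interval:
  assumes a: "cube_labelling G u a" and "subgraph H G" and "digraph_iso H (hypercube k)"
  obtains M D where "D \<subseteq> M" and "card D = k" and "a ` verts H = {M - D..M}"
proof -
  from assms(3) obtain h where h: "pre_digraph.digraph_isomorphism H h" and Q: "hypercube k = app_iso h H"
    by (auto simp: digraph_iso_def)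
  have sub: "verts H \<subseteq> verts G" "arcs H \<subseteq> arcs G" "tail H = tail G" "head H = head G"
    using \<open>subgraph H G\<close> by (auto simp: subgraph_def compatible_def)
  \<comment> \<open>Characteristic lists translate between sets and hypercube vertices. Members from
    \<open>k\<close> on are forgotten, hence the intersection with \<open>{..<k}\<close> in
    \<open>diff_b\<close>.\<close>
  define b where "b S = map (\<lambda>i. i \<in> S) [0..<k]" for S :: "nat set"
  have len_b: "length (b S) = k" for S by (simp add: b_def)
  define g where "g S = iso_verts (pre_digraph.inv_iso H h) (b S)" for S
  have iso: "iso_verts h ` verts H = {x. length x = k}"
    using arg_cong[OF Q, of verts] by simp
  have h_g: "iso_verts h (g S) = b S" and g_in: "g S \<in> verts H" for S
  proof -
    have "b S \<in> iso_verts h ` verts H" unfolding iso by (simp add: len_b)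
    then show "iso_verts h (g S) = b S" "g S \<in> verts H"
      using h by (auto simp: g_def pre_digraph.iso_verts_inv_iso)
  qed
  have diff_b: "diff_set k (b S) (b T) = sym_diff S T \<inter> {..<k}" for S T
    by (auto simp: diff_set_def b_def)
  have "g ` Pow {..<k} = verts H"
  proof (intro equalityI subsetI)
    fix v assume v: "v \<in> verts H"
    define S where "S = {i. i < k \<and> iso_verts h v ! i}"
    have "length (iso_verts h v) = k" using v iso by auto
    then have "iso_verts h v = b S" by (auto simp: b_def S_def intro: nth_equalityI)
    then have "v = g S" using h v h_g g_in by (metis pre_digraph.iso_verts_eq_iff)
    moreover have "S \<subseteq> {..<k}" by (auto simp: S_def)
    ultimately show "v \<in> g ` Pow {..<k}" by blast
  qed (use g_in in auto)
  then have img: "a ` verts H = (a \<circ> g) ` Pow {..<k}" by (metis image_comp)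
  have "inj_on (a \<circ> g) (Pow {..<k})"
  proof (rule inj_onI)
    fix S T assume ST: "S \<in> Pow {..<k}" "T \<in> Pow {..<k}" "(a \<circ> g) S = (a \<circ> g) T"
    then have "g S = g T"
      using a g_in sub(1) by (metis comp_apply cube_labelling_def inj_onD subsetD)
    then have "b S = b T" using h_g by metis
    then have "diff_set k (b S) (b T) = {}" by (simp add: diff_set_def)
    with ST show "S = T" unfolding diff_b by blast
  qed
  moreover have "card (sym_diff ((a \<circ> g) S) ((a \<circ> g) (insert i S))) = 1"
    if "S \<subseteq> {..<k}" "i \<in> {..<k}" "i \<notin> S" for S i
  proof -
    have "sym_diff S (insert i S) \<inter> {..<k} = {i}" using that by auto
    then have "(b S, b (insert i S)) \<in> arcs (hypercube k)"
      using diff_b[of S "insert i S"] len_b by simp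
    \<comment> \<open>The arc of the hypercube is pulled back to \<open>H\<close> through
      \<open>h\<close>; its ends are then identified by injectivity of \<open>h\<close> on
      vertices.\<close>
    then obtain e where e: "e \<in> arcs H" "iso_arcs h e = (b S, b (insert i S))"
      unfolding Q by auto
    have "iso_tail h = fst" "iso_head h = snd"
      using arg_cong[OF Q, of tail] arg_cong[OF Q, of head] by simp_all
    then have "iso_verts h (tail H e) = b S" "iso_verts h (head H e) = b (insert i S)"
      using pre_digraph.iso_verts_tail[OF h e(1)] pre_digraph.iso_verts_head[OF h e(1)] e by simp_all
    moreover have "tail H e \<in> verts H" "head H e \<in> verts H"
      using h e(1) by (auto simp: pre_digraph.digraph_isomorphism_def wf_digraph_def)
    ultimately have "tail H e = g S" "head H e = g (insert i S)"
      using h h_g g_in by (metis pre_digraph.iso_verts_eq_iff)+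
    moreover have "card (sym_diff (a (tail H e)) (a (head H e))) = 1"
      using a e(1) sub by (metis cube_labelling_def subsetD)
    ultimately show ?thesis by (simp only: comp_apply)
  qed
  ultimately show ?thesis
    using cube_embedding_interval[of "{..<k}" "a \<circ> g"] that img by (metis card_lessThan finite_lessThan)
qed

text \<open>Distances from \<open>u\<close> are label sizes, and the least label of the interval is
  its bottom.\<close>

lemma dist_to_cube:
  assumes "cube_labelling G u a" and "finite (verts H)" and "verts H \<subseteq> verts G"
    and "a ` verts H = {M - D..M}"
  shows "dist_to_subgraph G u H = ereal (card (M - D))"
proof -
  have "gdist G u ` verts H = (\<lambda>v. ereal (card (a v))) ` verts H"
    using assms by (intro image_cong) (auto simp: cube_labelling_def)
  also have "\<dots> = (\<lambda>X. ereal (card X)) ` (a ` verts H)"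
    by (simp add: image_image)
  finally have im: "gdist G u ` verts H = (\<lambda>X. ereal (card X)) ` {M - D..M}"
    using assms by simp
  \<comment> \<open>As \<open>card\<close> is 0 on infinite sets, monotonicity requires finite
    labels; each member of the interval is the label of a vertex, so it is finite.\<close>
  have fin: "finite X" if "X \<in> {M - D..M}" for X
    using that assms unfolding assms(4)[symmetric] by (auto simp: cube_labelling_def)
  show ?thesis
    unfolding dist_to_subgraph_def
  proof (rule Min_eqI)
    show "finite (gdist G u ` verts H)" using assms(2) by simp
    show "ereal (card (M - D)) \<in> gdist G u ` verts H" unfolding im by auto
    fix y assume "y \<in> gdist G u ` verts H"
    then obtain X where "y = ereal (card X)" "X \<in> {M - D..M}" unfolding im by blast
    then show "ereal (card (M - D)) \<le> y" using fin by (auto intro: card_mono)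
  qed
qed

section \<open>Counting cubes by farthest vertex and directions\<close>

lemma cubes_at_dist_le:
  assumes "graph G" and a: "cube_labelling G u a"
  shows "cubes_at_dist G u k t \<le> (k + t choose k) * verts_at_dist G u (k + t)"
proof -
  interpret graph G by fact
  define C where "C = {H. induced_subgraph H G \<and> digraph_iso H (hypercube k) \<and>
     dist_to_subgraph G u H = ereal (real t)}"
  define V where "V = {v \<in> verts G. gdist G u v = ereal (real (k + t))}"
  \<comment> \<open>The pairs that encode cubes: a candidate farthest vertex, and the
    \<open>k\<close> elements of its label that vary within the cube. Each \<open>v\<close> allows
    \<open>k + t choose k\<close> such sets, as its label has \<open>k + t\<close> elements.\<close>
  define T where "T = (SIGMA v:V. {D. D \<subseteq> a v \<and> card D = k})"
  have V: "finite (a v)" "card (a v) = k + t" if "v \<in> V" for v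
    using that a by (auto simp: V_def cube_labelling_def)
  have "\<exists>p. p \<in> T \<and> a ` verts H = {a (fst p) - snd p..a (fst p)}" if "H \<in> C" for H
  proof -
    from that have sub: "subgraph H G" and iso: "digraph_iso H (hypercube k)"
      and dist: "dist_to_subgraph G u H = ereal (real t)"
      by (auto simp: C_def induced_subgraph_def)
    obtain M D where MD: "D \<subseteq> M" "card D = k" "a ` verts H = {M - D..M}"
      using cube_labels_interval[OF a sub iso] .
    have vs: "verts H \<subseteq> verts G" using sub by (auto simp: subgraph_def)
    have "M \<in> a ` verts H" unfolding MD by auto
    then obtain v where v: "v \<in> verts H" "a v = M" by auto
    then have v': "v \<in> verts G" "finite M" "gdist G u v = ereal (card M)"
      using vs a by (auto simp: cube_labelling_def)
    have "card (M - D) = t"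
      using dist_to_cube[OF a _ vs MD(3)] vs dist finite_subset[OF vs] by simp
    then have "card M = k + t"
      using MD v' by (metis card_Diff_subset card_mono finite_subset le_add_diff_inverse)
    then have "(v, D) \<in> T" using v v' MD by (simp add: T_def V_def)
    with MD v show ?thesis by (intro exI[of _ "(v, D)"]) simp
  qed
  then have "\<forall>H\<in>C. \<exists>p. p \<in> T \<and> a ` verts H = {a (fst p) - snd p..a (fst p)}"
    by blast
  then obtain f where f: "\<And>H. H \<in> C \<Longrightarrow> f H \<in> T \<and>
      a ` verts H = {a (fst (f H)) - snd (f H)..a (fst (f H))}"
    unfolding bchoice_iff by blast
  \<comment> \<open>The pair fixes the interval of labels, which fixes the vertex set because
    \<open>a\<close> is injective; an induced subgraph is recovered from its vertices.\<close>
  have "inj_on f C"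
  proof (rule inj_onI)
    fix H K assume HK: "H \<in> C" "K \<in> C" "f H = f K"
    then have ind: "induced_subgraph H G" "induced_subgraph K G" by (auto simp: C_def)
    have "a ` verts H = a ` verts K" using f[OF HK(1)] f[OF HK(2)] HK(3) by simp
    moreover have "verts H \<subseteq> verts G" "verts K \<subseteq> verts G"
      using ind by (auto simp: induced_subgraph_def subgraph_def)
    ultimately have "verts H = verts K"
      using a inj_on_image_eq_iff by (metis cube_labelling_def)
    with ind show "H = K"
      by (intro pre_digraph.equality) (auto simp: induced_subgraph_def subgraph_def compatible_def)
  qed
  moreover have "f ` C \<subseteq> T" using f by blast
  moreover have "finite V" by (simp add: V_def)
  moreover have "finite T" unfolding T_def
    by (rule finite_SigmaI) (use V \<open>finite V\<close> in auto)
  ultimately have "card C \<le> card T" by (metis card_inj_on_le)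
  also have "\<dots> = (\<Sum>v\<in>V. card {D. D \<subseteq> a v \<and> card D = k})"
    unfolding T_def by (rule card_SigmaI) (use V \<open>finite V\<close> in auto)
  also have "\<dots> = (\<Sum>v\<in>V. k + t choose k)"
    by (rule sum.cong) (use V in \<open>auto simp: n_subsets\<close>)
  finally show ?thesis
    by (simp add: cubes_at_dist_def verts_at_dist_def C_def V_def mult.commute)
qed

theorem theorem2:
  fixes G :: "('a,'b) pre_digraph" and u :: 'a
  assumes "partial_cube G" and "u \<in> verts G"
  shows "D_poly G u \<preceq> subst2 (W_poly G u) (var_x + var_y)"
proof -
  interpret graph G using assms(1) by (simp add: partial_cube_def)
  obtain a :: "'a \<Rightarrow> nat set" where a: "cube_labelling G u a"
    using partial_cube_labelling[OF assms] .
  show ?thesis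
    unfolding poly2_le_def using cubes_at_dist_le[OF graph_axioms a]
    by (simp add: coeff2_subst2 coeff_W_poly coeff2_D_poly)
qed

end
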